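(* For every $k$ with $2 \le k \le n$ (where $k$ may depend on $n$), the worst-case approximation ratio of the grammar-based compressor BISECTION satisfies $$\alpha_{\mathrm{BI}}(k,n) \in \Theta\left(\sqrt{n/\log n}\right).$$ That is, there are constants $c_1,c_2>0$ and $n_0$ such that for all $n\ge n_0$ and all $k$ with $2\le k\le n$ we have $c_1\sqrt{n/\log n}\le \alpha_{\mathrm{BI}}(k,n)\le c_2\sqrt{n/\log n}$.
   Context: A straight-line program (SLP) over a finite alphabet $\Sigma$ is a context-free grammar $\mathbb{A}=(N,\Sigma,P,S)$ with a finite set $N$ of nonterminals ($N\cap\Sigma=\emptyset$), start nonterminal $S\in N$, and a finite set $P$ of productions $A\to w$ with $A\in N$, $w\in(N\cup\Sigma)^+$, such that (i) for every $A\in N$ there is exactly one production with left-hand side $A$, and (ii) the relation $\{(A,B)\in N\times N \mid (A\to w)\in P,\ B \text{ occurs in } w\}$ is acyclic. Every nonterminal $A$ produces a unique word $\mathrm{val}(A)\in\Sigma^+$, and $\mathrm{val}(\mathbb{A})=\mathrm{val}(S)$. The size of $\mathbb{A}$ is $|\mathbb{A}|=\sum_{(A\to w)\in P}|w|$. For a nonempty word $w$, $g(w)$ denotes the size of a smallest SLP producing $w$. A grammar-based compressor $\mathcal{C}$ computes for each nonempty word $w$ an SLP $\mathcal{C}(w)$ with $\mathrm{val}(\mathcal{C}(w))=w$. With $[1,k]=\{1,\dots,k\}$, its worst-case approximation ratio is $$\alpha_{\mathcal{C}}(k,n)=\max\{|\mathcal{C}(w)|/g(w) \mid w\in[1,k]^n\}.$$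 BISECTION: an input word $w$ with $|w|\ge 2$ is split as $w=w_1w_2$ with $|w_1|=2^j$, where $j\ge 0$ is the unique number with $2^j<|w|\le 2^{j+1}$. This is repeated recursively with $w_1$ and $w_2$ until words of length $1$ are obtained. One nonterminal is introduced for each distinct word of length at least two that arises in this process (including $w$ itself, whose nonterminal is the start nonterminal), and its rule has a right-hand side consisting of exactly two symbols corresponding to the two parts of its split (a part of length $1$ is represented by the corresponding terminal, a longer part by its nonterminal). For $|w|=1$ the SLP is $S\to w$. The approximation ratio of BISECTION is denoted $\alpha_{\mathrm{BI}}$. *)

theory Defs
  imports Complex_Main
begin

text \<open>
  A symbol is \<open>Inl A\<close> for a nonterminal \<open>A\<close> and \<open>Inr a\<close> for a
  terminal \<open>a\<close>, so nonterminals and terminals are disjoint by construction.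
\<close>

record ('n, 'a) grammar =
  nonterminals :: "'n set"
  terminals :: "'a set"
  productions :: "('n \<times> ('n + 'a) list) set"
  start :: 'n

definition is_slp :: "('n, 'a) grammar \<Rightarrow> bool" where
  "is_slp G \<longleftrightarrow>
     finite (nonterminals G) \<and> finite (terminals G) \<and> finite (productions G) \<and>
     start G \<in> nonterminals G \<and>
     (\<forall>(A, u) \<in> productions G. A \<in> nonterminals G \<and> u \<noteq> [] \<and>
        set u \<subseteq> Inl ` nonterminals G \<union> Inr ` terminals G) \<and>
     (\<forall>A \<in> nonterminals G. \<exists>!u. (A, u) \<in> productions G) \<and>
     acyclic {(A, B). A \<in> nonterminals G \<and> B \<in> nonterminals G \<and>
        (\<exists>u. (A, u) \<in> productions G \<and> Inl B \<in> set u)}"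

inductive derives1 :: "('n, 'a) grammar \<Rightarrow> ('n + 'a) list \<Rightarrow> ('n + 'a) list \<Rightarrow> bool"
  for G where
  "(A, u) \<in> productions G \<Longrightarrow> derives1 G (x @ Inl A # y) (x @ u @ y)"

definition val_nt :: "('n, 'a) grammar \<Rightarrow> 'n \<Rightarrow> 'a list" where
  "val_nt G A = (THE w. (derives1 G)\<^sup>*\<^sup>* [Inl A] (map Inr w))"

definition val :: "('n, 'a) grammar \<Rightarrow> 'a list" where
  "val G = val_nt G (start G)"

definition slp_size :: "('n, 'a) grammar \<Rightarrow> nat" where
  "slp_size G = (\<Sum>(A, u) \<in> productions G. length u)"

text \<open>
  Since sets of nonterminals are finite, every SLP can be renamed to one whose nonterminals are
  natural numbers; hence fixing the type of nonterminals here is no restriction.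
\<close>

definition g :: "'a list \<Rightarrow> nat" where
  "g w = (LEAST m. \<exists>G :: (nat, 'a) grammar. is_slp G \<and> val G = w \<and> slp_size G = m)"

definition words :: "nat \<Rightarrow> nat \<Rightarrow> nat list set" where
  "words k n = {w. length w = n \<and> set w \<subseteq> {1..k}}"

definition approx_ratio :: "(nat list \<Rightarrow> ('n, nat) grammar) \<Rightarrow> nat \<Rightarrow> nat \<Rightarrow> real" where
  "approx_ratio C k n = Max ((\<lambda>w. real (slp_size (C w)) / real (g w)) ` words k n)"

definition split_exponent :: "nat \<Rightarrow> nat" where
  "split_exponent m = (THE j. 2 ^ j < m \<and> m \<le> 2 ^ (j + 1))"

definition left_part :: "'a list \<Rightarrow> 'a list" where
  "left_part w = take (2 ^ split_exponent (length w)) w"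

definition right_part :: "'a list \<Rightarrow> 'a list" where
  "right_part w = drop (2 ^ split_exponent (length w)) w"

inductive_set bisection_words :: "'a list \<Rightarrow> 'a list set" for w where
  "w \<in> bisection_words w"
| "v \<in> bisection_words w \<Longrightarrow> length v \<ge> 2 \<Longrightarrow> left_part v \<in> bisection_words w"
| "v \<in> bisection_words w \<Longrightarrow> length v \<ge> 2 \<Longrightarrow> right_part v \<in> bisection_words w"

text \<open>The nonterminal introduced for a word is that word itself.\<close>

definition word_symbol :: "'a list \<Rightarrow> 'a list + 'a" where
  "word_symbol v = (if length v = 1 then Inr (hd v) else Inl v)"

definition bisection :: "'a list \<Rightarrow> ('a list, 'a) grammar" where
  "bisection w =
     (if length w \<ge> 2 then
        (let N = {v \<in> bisection_words w. length v \<ge> 2} in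
           \<lparr>nonterminals = N, terminals = set w,
            productions = {(v, [word_symbol (left_part v), word_symbol (right_part v)]) | v. v \<in> N},
            start = w\<rparr>)
      else
        \<lparr>nonterminals = {w}, terminals = set w, productions = {(w, [Inr (hd w)])}, start = w\<rparr>)"

end

theory Submission
  imports Defs
begin

text \<open>
  Upper bound. Every word created by BISECTION is a block of length \<open>2 ^ i\<close> starting at a multiple
  of \<open>2 ^ i\<close>, except for at most one truncated block per level. With
  \<open>n = |w|\<close>, level \<open>i\<close> has at most \<open>n / 2 ^ i\<close> full blocks, and at most \<open>g w * 2 ^ i\<close>
  distinct ones, because each factor of length \<open>m \<ge> 2\<close> straddles a boundary inside the right-hand
  side of some production. Summing the minimum over all levels gives \<open>O(sqrt (n * g w))\<close>, and
  \<open>log n \<le> g w\<close>.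

  Lower bound. Let \<open>2 ^ J < n \<le> 2 ^ (J + 1)\<close> and \<open>m = 2 ^ b\<close> of order \<open>sqrt (n / J)\<close>. The word
  \<open>P = y x^(m-1) y^2 x^(m-2) ... y^J x^(m-J) x\<close> has length \<open>J * m + 1\<close>, so in \<open>P ^ (m / 2)\<close> each
  copy is shifted by one more position relative to the aligned blocks of length \<open>m\<close>. These blocks
  are therefore the \<open>J * m / 2\<close> distinct words \<open>x^r y^j x^(m-j-r)\<close>, while a power of \<open>P\<close>
  padded with \<open>x\<close> has an SLP of size \<open>O(J)\<close>.
\<close>

subsection \<open>Semantics of straight-line programs\<close>

text \<open>The homomorphic extension of \<open>f\<close> to sentential forms that fixes every
  terminal.\<close>

definition expand :: "('n \<Rightarrow> 'a list) \<Rightarrow> ('n + 'a) list \<Rightarrow> 'a list" where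
  "expand f u = concat (map (case_sum f (\<lambda>a. [a])) u)"

lemma expand_simps [simp]:
  "expand f [] = []"
  "expand f (Inl A # u) = f A @ expand f u"
  "expand f (Inr a # u) = a # expand f u"
  "expand f (u @ v) = expand f u @ expand f v"
  by (simp_all add: expand_def)

lemma expand_map_Inr [simp]: "expand f (map Inr w) = w"
  by (induction w) auto

text \<open>Solving this system of equations replaces reasoning about derivations; for an SLP the
  solution agrees with \<open>val\<close> (see \<open>val_eq_interpretation\<close>).\<close>

definition interprets :: "('n \<Rightarrow> 'a list) \<Rightarrow> ('n, 'a) grammar \<Rightarrow> bool" where
  "interprets f G \<longleftrightarrow> (\<forall>(A, u) \<in> productions G. f A = expand f u)"

lemma derives_expand_eq:
  assumes "(derives1 G)\<^sup>*\<^sup>* x y" "interprets f G"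
  shows "expand f x = expand f y"
  using assms(1)
proof induction
  case (step y z)
  from step.hyps(2) have "expand f y = expand f z"
    by cases (use assms(2) in \<open>auto simp: interprets_def\<close>)
  with step.IH show ?case by simp
qed simp

lemma derives1_context:
  assumes "derives1 G u v"
  shows "derives1 G (x @ u @ y) (x @ v @ y)"
  using assms
proof cases
  case (1 A r p q)
  then show ?thesis using derives1.intros[of A r G "x @ p" "q @ y"] by simp
qed

lemma derives_context:
  assumes "(derives1 G)\<^sup>*\<^sup>* u v"
  shows "(derives1 G)\<^sup>*\<^sup>* (x @ u @ y) (x @ v @ y)"
  using assms by induction (auto intro: derives1_context rtranclp.rtrancl_into_rtrancl)

text \<open>The converse of the relation in \<open>is_slp\<close>: pairs go from child to parent, so
  that induction reaches the symbols of a right-hand side before the nonterminal itself.\<close>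

definition occurs_in :: "('n, 'a) grammar \<Rightarrow> ('n \<times> 'n) set" where
  "occurs_in G = {(B, A). A \<in> nonterminals G \<and> B \<in> nonterminals G \<and>
     (\<exists>u. (A, u) \<in> productions G \<and> Inl B \<in> set u)}"

lemma wf_occurs_in:
  assumes "is_slp G"
  shows "wf (occurs_in G)"
proof -
  let ?R = "{(A, B). A \<in> nonterminals G \<and> B \<in> nonterminals G \<and>
        (\<exists>u. (A, u) \<in> productions G \<and> Inl B \<in> set u)}"
  have "?R \<subseteq> nonterminals G \<times> nonterminals G" by auto
  with assms have "finite ?R" "acyclic ?R"
    by (auto simp: is_slp_def intro: finite_subset)
  hence "wf (?R\<inverse>)" by (rule finite_acyclic_wf_converse)
  also have "?R\<inverse> = occurs_in G" by (auto simp: occurs_in_def)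
  finally show ?thesis .
qed

definition rhs :: "('n, 'a) grammar \<Rightarrow> 'n \<Rightarrow> ('n + 'a) list" where
  "rhs G A = (THE u. (A, u) \<in> productions G)"

lemma productions_eq_rhs:
  assumes "is_slp G"
  shows "productions G = (\<lambda>A. (A, rhs G A)) ` nonterminals G"
proof -
  have ex1: "\<exists>!u. (A, u) \<in> productions G" if "A \<in> nonterminals G" for A
    using assms that by (auto simp: is_slp_def)
  hence *: "(A, rhs G A) \<in> productions G" if "A \<in> nonterminals G" for A
    unfolding rhs_def using theI'[OF ex1[OF that]] by simp
  have "A \<in> nonterminals G \<and> u = rhs G A" if "(A, u) \<in> productions G" for A u
  proof -
    have "A \<in> nonterminals G" using assms that by (auto simp: is_slp_def)
    with * ex1 that show ?thesis by blast
  qed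
  with * show ?thesis by auto
qed

lemma rhs_props:
  assumes "is_slp G" "A \<in> nonterminals G"
  shows "rhs G A \<noteq> []" "\<And>B. Inl B \<in> set (rhs G A) \<Longrightarrow> B \<in> nonterminals G"
    "\<And>B. Inl B \<in> set (rhs G A) \<Longrightarrow> (B, A) \<in> occurs_in G"
proof -
  have p: "(A, rhs G A) \<in> productions G" using assms by (simp add: productions_eq_rhs)
  with assms(1) have "rhs G A \<noteq> [] \<and> set (rhs G A) \<subseteq> Inl ` nonterminals G \<union> Inr ` terminals G"
    unfolding is_slp_def by fast
  then show "rhs G A \<noteq> []" and *: "\<And>B. Inl B \<in> set (rhs G A) \<Longrightarrow> B \<in> nonterminals G"
    by auto
  show "\<And>B. Inl B \<in> set (rhs G A) \<Longrightarrow> (B, A) \<in> occurs_in G"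
    using p * assms(2) by (auto simp: occurs_in_def)
qed

lemma interprets_iff_rhs:
  assumes "is_slp G"
  shows "interprets f G \<longleftrightarrow> (\<forall>A \<in> nonterminals G. f A = expand f (rhs G A))"
  using assms by (auto simp: interprets_def productions_eq_rhs)

lemma slp_size_eq_rhs:
  assumes "is_slp G"
  shows "slp_size G = (\<Sum>A \<in> nonterminals G. length (rhs G A))"
  unfolding slp_size_def productions_eq_rhs[OF assms]
  by (subst sum.reindex) (auto simp: inj_on_def)

lemma expand_cong:
  assumes "\<And>B. Inl B \<in> set u \<Longrightarrow> f B = h B"
  shows "expand f u = expand h u"
  using assms unfolding expand_def
  by (intro arg_cong[where f = concat] map_cong) (auto split: sum.splits)

text \<open>Well-founded recursion along \<open>occurs_in\<close> solves the equations: a right-hand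
  side consults \<open>f\<close> only below its own nonterminal, so the cut-off function does no
  harm.\<close>

lemma exists_interpretation:
  assumes "is_slp G"
  shows "\<exists>f. interprets f G"
proof -
  define f where "f = wfrec (occurs_in G) (\<lambda>h A. expand h (rhs G A))"
  have "f A = expand f (rhs G A)" if "A \<in> nonterminals G" for A
  proof -
    have "f A = expand (cut f (occurs_in G) A) (rhs G A)"
      unfolding f_def by (rule wfrec[OF wf_occurs_in[OF assms]])
    also have "\<dots> = expand f (rhs G A)"
      using rhs_props[OF assms that] by (intro expand_cong) (simp add: cut_apply)
    finally show ?thesis .
  qed
  with assms show ?thesis by (auto simp: interprets_iff_rhs)
qed

lemma derives_interpretation:
  assumes "is_slp G" "interprets f G" "A \<in> nonterminals G"
  shows "(derives1 G)\<^sup>*\<^sup>* [Inl A] (map Inr (f A))"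
  using wf_occurs_in[OF assms(1)] assms(3)
proof (induction A)
  case (less A)
  \<comment> \<open>Stated for every list of symbols from the right-hand side, so that the symbols
    can be rewritten one at a time by list induction.\<close>
  have *: "(derives1 G)\<^sup>*\<^sup>* u (map Inr (expand f u))" if "set u \<subseteq> set (rhs G A)" for u
    using that
  proof (induction u)
    case (Cons s u)
    have "(derives1 G)\<^sup>*\<^sup>* (s # u) (s # map Inr (expand f u))"
      using derives_context[of G u "map Inr (expand f u)" "[s]" "[]"] Cons by simp
    moreover have "(derives1 G)\<^sup>*\<^sup>* (s # map Inr (expand f u)) (map Inr (expand f (s # u)))"
    proof (cases s)
      case (Inl B)
      with Cons.prems have "Inl B \<in> set (rhs G A)" by auto
      hence "(derives1 G)\<^sup>*\<^sup>* [Inl B] (map Inr (f B))"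
        using less.IH rhs_props[OF assms(1) less.prems] by blast
      from derives_context[OF this, of "[]"] show ?thesis by (simp add: Inl)
    qed simp
    ultimately show ?case by simp
  qed simp
  have "(A, rhs G A) \<in> productions G"
    using assms(1) less.prems by (simp add: productions_eq_rhs)
  from derives1.intros[OF this, of "[]" "[]"]
  have "derives1 G [Inl A] (rhs G A)" by simp
  moreover have "f A = expand f (rhs G A)"
    using assms(1,2) less.prems by (simp add: interprets_iff_rhs)
  ultimately show ?case using *[of "rhs G A"] by simp
qed

text \<open>Existence of the derived word is \<open>derives_interpretation\<close>. Uniqueness holds
  because rewriting preserves \<open>expand f\<close>, which is the identity on terminal
  words.\<close>

lemma val_eq_interpretation:
  assumes "is_slp G" "interprets f G"
  shows "val G = f (start G)"
proof -
  have start: "start G \<in> nonterminals G" using assms(1) by (simp add: is_slp_def)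
  show ?thesis unfolding val_def val_nt_def
  proof (rule the_equality)
    fix w assume "(derives1 G)\<^sup>*\<^sup>* [Inl (start G)] (map Inr w)"
    from derives_expand_eq[OF this assms(2)] show "w = f (start G)" by simp
  qed (rule derives_interpretation[OF assms start])
qed

subsection \<open>Incremental construction of straight-line programs\<close>

text \<open>
  \<open>straight_line S m\<close>: the words in \<open>S\<close> are the values of nonterminals whose right-hand sides have
  total length \<open>m\<close>. Words of length 1 need no nonterminal.
\<close>
inductive straight_line :: "'a list set \<Rightarrow> nat \<Rightarrow> bool" where
  empty: "straight_line {} 0"
| insert: "straight_line S m \<Longrightarrow> us \<noteq> [] \<Longrightarrow> (\<And>u. u \<in> set us \<Longrightarrow> u \<in> S \<or> length u = 1) \<Longrightarrow>
    straight_line (insert (concat us) S) (m + length us)"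

text \<open>Nonterminals are numbered in order of insertion, so rules refer only to smaller numbers.
  Reinserting a word merely gives it a second number; \<open>f\<close> need not be
  injective.\<close>

lemma straight_line_rules:
  assumes "straight_line S m"
  shows "\<exists>p r f. S = f ` {..<p::nat} \<and>
    (\<forall>i<p. r i \<noteq> [] \<and> (\<forall>j. Inl j \<in> set (r i) \<longrightarrow> j < i) \<and> f i = expand f (r i)) \<and>
    (\<Sum>i<p. length (r i)) = m"
  using assms
proof induction
  case (insert S m us)
  then obtain p r f where S: "S = f ` {..<p::nat}"
    and r: "\<And>i. i < p \<Longrightarrow> r i \<noteq> [] \<and> (\<forall>j. Inl j \<in> set (r i) \<longrightarrow> j < i) \<and> f i = expand f (r i)"
    and m: "(\<Sum>i<p. length (r i)) = m" by blast
  have "\<exists>s. (\<forall>j. s = Inl j \<longrightarrow> j < p) \<and> expand f [s] = u" if "u \<in> set us" for u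
  proof (cases "u \<in> S")
    case True
    then obtain j where "j < p" "u = f j" using S by auto
    then show ?thesis by (intro exI[of _ "Inl j"]) simp
  next
    case False
    then obtain a where "u = [a]" using insert.hyps(3)[OF \<open>u \<in> set us\<close>]
      by (auto simp: length_Suc_conv)
    then show ?thesis by (intro exI[of _ "Inr a"]) simp
  qed
  then obtain s where s: "\<And>u j. u \<in> set us \<Longrightarrow> s u = Inl j \<Longrightarrow> j < p"
    "\<And>u. u \<in> set us \<Longrightarrow> expand f [s u] = u" by metis
  have "expand f (map s us) = concat (map (\<lambda>u. expand f [s u]) us)"
    by (simp add: expand_def comp_def)
  also have "map (\<lambda>u. expand f [s u]) us = us" using s(2) by (simp add: map_idI)
  finally have ex: "expand f (map s us) = concat us" .
  define f' where "f' = f(p := concat us)"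
  define r' where "r' = r(p := map s us)"
  have f': "expand f' u = expand f u" if "\<forall>j. Inl j \<in> set u \<longrightarrow> j < p" for u
    using that by (intro expand_cong) (auto simp: f'_def)
  have sm: "\<forall>j. Inl j \<in> set (map s us) \<longrightarrow> j < p"
    using s(1) by (metis (no_types, lifting) imageE list.set_map)
  have "r' i \<noteq> [] \<and> (\<forall>j. Inl j \<in> set (r' i) \<longrightarrow> j < i) \<and> f' i = expand f' (r' i)"
    if "i < Suc p" for i
  proof (cases "i = p")
    case True
    then show ?thesis using sm ex insert.hyps(2) f'[OF sm] by (simp add: r'_def f'_def)
  next
    case False
    with that have "i < p" by simp
    from r[OF this] \<open>i < p\<close> have "expand f' (r i) = expand f (r i)"
      by (intro f') (meson less_trans)
    with r[OF \<open>i < p\<close>] False show ?thesis by (simp add: r'_def f'_def)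
  qed
  moreover have "insert (concat us) S = f' ` {..<Suc p}"
    unfolding S by (auto simp: f'_def lessThan_Suc)
  moreover have "(\<Sum>i<Suc p. length (r' i)) = m + length us"
    using m by (simp add: r'_def)
  ultimately show ?case by blast
qed auto

lemma straight_line_slp:
  fixes w :: "'a list"
  assumes "straight_line S m" "w \<in> S"
  shows "\<exists>G :: (nat, 'a) grammar. is_slp G \<and> val G = w \<and> slp_size G = m"
proof -
  from straight_line_rules[OF assms(1)] obtain p r f where S: "S = f ` {..<p::nat}"
    and r: "\<And>i. i < p \<Longrightarrow> r i \<noteq> []" "\<And>i j. i < p \<Longrightarrow> Inl j \<in> set (r i) \<Longrightarrow> j < i"
      "\<And>i. i < p \<Longrightarrow> f i = expand f (r i)"
    and m: "(\<Sum>i<p. length (r i)) = m" by blast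
  from assms(2) S obtain i where i: "i < p" "w = f i" by auto
  define G where "G = \<lparr>nonterminals = {..<p}, terminals = {a. \<exists>i<p. Inr a \<in> set (r i)},
    productions = (\<lambda>i. (i, r i)) ` {..<p}, start = i\<rparr>"
  have fin: "finite {a. \<exists>i<p. Inr a \<in> set (r i)}"
  proof (rule finite_subset)
    show "{a. \<exists>i<p. Inr a \<in> set (r i)} \<subseteq> Inr -` (\<Union>i<p. set (r i))" by auto
  qed (auto intro: finite_vimageI)
  have sub: "set (r i) \<subseteq> Inl ` {..<p} \<union> Inr ` {a. \<exists>i<p. Inr a \<in> set (r i)}" if "i < p" for i
  proof
    fix s assume "s \<in> set (r i)"
    with that r(2)[OF that] show "s \<in> Inl ` {..<p} \<union> Inr ` {a. \<exists>i<p. Inr a \<in> set (r i)}"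
      by (cases s rule: sum.exhaust) (auto intro: less_trans)
  qed
  have "acyclic {(A, B). A \<in> nonterminals G \<and> B \<in> nonterminals G \<and>
        (\<exists>u. (A, u) \<in> productions G \<and> Inl B \<in> set u)}"
  \<comment> \<open>Numbers strictly decrease from a nonterminal to the symbols of its rule.\<close>
  proof (rule acyclic_subset)
    show "acyclic ({(i, j). i < j}\<inverse> :: (nat \<times> nat) set)"
      using wf_acyclic[OF wf_less] by (simp only: acyclic_converse)
  qed (auto simp: G_def dest: r(2))
  then have G: "is_slp G"
    unfolding is_slp_def using i fin sub r(1) by (auto simp: G_def)
  moreover have "interprets f G" using r(3) by (auto simp: interprets_def G_def)
  ultimately have "val G = w" using val_eq_interpretation i by (fastforce simp: G_def)
  moreover have "slp_size G = m"
    unfolding slp_size_def G_def using m by (simp add: sum.reindex inj_on_def)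
  ultimately show ?thesis using G by blast
qed

lemma g_le_straight_line:
  assumes "straight_line S m" "w \<in> S"
  shows "g w \<le> m"
  using straight_line_slp[OF assms] unfolding g_def by (intro Least_le) blast

lemma straight_line_word:
  assumes "w \<noteq> []"
  shows "straight_line {w} (length w)"
proof -
  have "straight_line (insert (concat (map (\<lambda>a. [a]) w)) {}) (0 + length (map (\<lambda>a. [a]) w))"
    using assms by (intro straight_line.intros) auto
  then show ?thesis by simp
qed

lemma g_le_length: "w \<noteq> [] \<Longrightarrow> g w \<le> length w"
  using g_le_straight_line[OF straight_line_word] by auto

text \<open>The grammar with the single rule producing \<open>w\<close> letter by letter shows that
  the minimum in \<open>g\<close> is over a nonempty set.\<close>

lemma g_attained:
  fixes w :: "'a list"
  assumes "w \<noteq> []"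
  obtains G :: "(nat, 'a) grammar" where "is_slp G" "val G = w" "slp_size G = g w"
proof -
  have "straight_line {w} (length w)" by (rule straight_line_word[OF assms])
  from straight_line_slp[OF this, of w]
  have "\<exists>m. \<exists>G :: (nat, 'a) grammar. is_slp G \<and> val G = w \<and> slp_size G = m" by blast
  from LeastI_ex[OF this] that show ?thesis unfolding g_def by blast
qed

subsection \<open>Lower bounds on the size of a straight-line program\<close>

lemma prod_mono_subset_nat:
  fixes h :: "'b \<Rightarrow> nat"
  assumes "finite Y" "X \<subseteq> Y" "\<And>y. y \<in> Y \<Longrightarrow> 1 \<le> h y"
  shows "prod h X \<le> prod h Y"
proof (rule dvd_imp_le)
  show "prod h X dvd prod h Y" using assms(1,2) by (rule prod_dvd_prod_subset)
  show "0 < prod h Y" using assms(3) by (intro prod_pos) force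
qed

text \<open>The length of \<open>f A\<close> is at most the length of its rule times the bound for
  its longest symbol. Each reachable rule enters the product only once, even if it is used many
  times.\<close>

lemma length_le_prod_rhs:
  assumes "is_slp G" "interprets f G" "A \<in> nonterminals G"
  shows "length (f A) \<le> (\<Prod>B | (B, A) \<in> (occurs_in G)\<^sup>*. length (rhs G B))"
  using wf_occurs_in[OF assms(1)] assms(3)
proof (induction A)
  case (less A)
  let ?D = "\<lambda>A. {B. (B, A) \<in> (occurs_in G)\<^sup>*}"
  let ?P = "\<lambda>X. \<Prod>B\<in>X. length (rhs G B)"
  have D: "?D A \<subseteq> nonterminals G"
  proof safe
    fix B assume "(B, A) \<in> (occurs_in G)\<^sup>*"
    then show "B \<in> nonterminals G"
      by (cases rule: converse_rtranclE) (use less.prems in \<open>auto simp: occurs_in_def\<close>)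
  qed
  have fin: "finite (?D A)"
    using assms(1) D by (auto simp: is_slp_def intro: finite_subset)
  have pos: "1 \<le> length (rhs G B)" if "B \<in> ?D A" for B
    using rhs_props(1)[OF assms(1)] D that by (simp add: Suc_leI subset_iff)
  have len: "length (expand f u) \<le> length u * ?P (?D A - {A})" if "set u \<subseteq> set (rhs G A)" for u
    using that
  proof (induction u)
    case (Cons s u)
    have "length (expand f [s]) \<le> ?P (?D A - {A})"
    proof (cases s)
      case (Inl B)
      with Cons.prems have "Inl B \<in> set (rhs G A)" by auto
      note B = rhs_props(2,3)[OF assms(1) less.prems this]
      \<comment> \<open>By acyclicity \<open>A\<close> is not reachable from its child
        \<open>B\<close>, so the factor for \<open>A\<close> is still available.\<close>
      have "(A, A) \<notin> (occurs_in G)\<^sup>+"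
        using wf_acyclic[OF wf_occurs_in[OF assms(1)]] by (simp add: acyclic_def)
      hence sub: "?D B \<subseteq> ?D A - {A}"
        using B(2) by (auto intro: rtrancl_into_trancl1)
      have "length (f B) \<le> ?P (?D B)" using less.IH B by blast
      also have "\<dots> \<le> ?P (?D A - {A})"
        using fin sub pos by (intro prod_mono_subset_nat) auto
      finally show ?thesis by (simp add: Inl)
    next
      case (Inr a)
      have "1 \<le> ?P (?D A - {A})" using pos by (intro prod_ge_1) auto
      then show ?thesis by (simp add: Inr)
    qed
    then show ?case using Cons by (cases s) auto
  qed simp
  have "length (f A) \<le> length (rhs G A) * ?P (?D A - {A})"
    using len[of "rhs G A"] assms(1,2) less.prems by (simp add: interprets_iff_rhs)
  also have "\<dots> = ?P (?D A)" using prod.remove[OF fin, of A "\<lambda>B. length (rhs G B)"] by simp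
  finally show ?case .
qed

text \<open>Bounding each factor \<open>l\<close> of the product by \<open>2 ^ l\<close> turns the
  product of rule lengths into a power of the size.\<close>

lemma length_val_le:
  assumes "is_slp G"
  shows "length (val G) \<le> 2 ^ slp_size G"
proof -
  obtain f where f: "interprets f G" using exists_interpretation[OF assms] by blast
  let ?S = "start G" and ?N = "nonterminals G"
  have S: "?S \<in> ?N" and fin: "finite ?N" using assms by (auto simp: is_slp_def)
  have D: "{B. (B, ?S) \<in> (occurs_in G)\<^sup>*} \<subseteq> ?N"
  proof safe
    fix B assume "(B, ?S) \<in> (occurs_in G)\<^sup>*"
    then show "B \<in> ?N"
      by (cases rule: converse_rtranclE) (use S in \<open>auto simp: occurs_in_def\<close>)
  qed
  have "length (val G) \<le> (\<Prod>B | (B, ?S) \<in> (occurs_in G)\<^sup>*. length (rhs G B))"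
    using length_le_prod_rhs[OF assms f S] val_eq_interpretation[OF assms f] by simp
  also have "\<dots> \<le> (\<Prod>B\<in>?N. length (rhs G B))"
    using fin D rhs_props(1)[OF assms] by (intro prod_mono_subset_nat) (auto simp: Suc_leI)
  also have "\<dots> \<le> (\<Prod>B\<in>?N. 2 ^ length (rhs G B))"
    by (intro prod_mono) (auto intro: less_imp_le less_exp)
  also have "\<dots> = 2 ^ slp_size G" by (simp add: slp_size_eq_rhs[OF assms] power_sum)
  finally show ?thesis .
qed

section \<open>Counting the distinct factors of a fixed length\<close>

definition factors :: "nat \<Rightarrow> 'a list \<Rightarrow> 'a list set" where
  "factors m w = {take m (drop i w) | i. i + m \<le> length w}"

lemma factors_eq_image: "factors m w = (\<lambda>i. take m (drop i w)) ` {i. i + m \<le> length w}"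
  by (auto simp: factors_def)

lemma finite_factors: "finite (factors m w)"
proof -
  have "{i. i + m \<le> length w} \<subseteq> {..length w}" by auto
  then show ?thesis unfolding factors_eq_image using finite_subset by blast
qed

text \<open>A factor lies in \<open>v\<close>, lies in \<open>w\<close>, or straddles the boundary;
  in the last case it is determined by the number \<open>j < m\<close> of letters it takes from
  \<open>v\<close>.\<close>

lemma factors_append:
  assumes "0 < m"
  shows "factors m (v @ w) \<subseteq> factors m v \<union> factors m w \<union>
    (\<lambda>j. take m (drop (length v - j) (v @ w))) ` {..<m}"
proof
  fix x assume "x \<in> factors m (v @ w)"
  then obtain i where i: "i + m \<le> length v + length w" "x = take m (drop i (v @ w))"
    by (auto simp: factors_def)
  consider "i + m \<le> length v" | "length v \<le> i" | "i < length v" "length v < i + m" by linarith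
  then show "x \<in> factors m v \<union> factors m w \<union>
    (\<lambda>j. take m (drop (length v - j) (v @ w))) ` {..<m}"
  proof cases
    case 1
    with i(2) have "x = take m (drop i v)" by simp
    with 1 show ?thesis by (auto simp: factors_def)
  next
    case 2
    with i have "x = take m (drop (i - length v) w)" "(i - length v) + m \<le> length w" by auto
    then show ?thesis unfolding factors_def by blast
  next
    case 3
    then have "x = take m (drop (length v - (length v - i)) (v @ w))" "length v - i < m"
      using i(2) by auto
    then show ?thesis by blast
  qed
qed

lemma factors_concat:
  assumes "0 < m"
  shows "\<exists>T. finite T \<and> card T \<le> length vs * m \<and>
    factors m (concat vs) \<subseteq> (\<Union>v\<in>set vs. factors m v) \<union> T"
proof (induction vs)
  case Nil
  with assms show ?case by (intro exI[of _ "{}"]) (auto simp: factors_def)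
next
  case (Cons v vs)
  then obtain T where T: "finite T" "card T \<le> length vs * m"
    "factors m (concat vs) \<subseteq> (\<Union>v\<in>set vs. factors m v) \<union> T" by blast
  define U where "U = (\<lambda>j. take m (drop (length v - j) (v @ concat vs))) ` {..<m}"
  have U: "finite U" "card U \<le> m"
    using card_image_le[of "{..<m}"] by (auto simp: U_def)
  have "factors m (concat (v # vs)) \<subseteq> (\<Union>v\<in>set (v # vs). factors m v) \<union> (T \<union> U)"
    using factors_append[OF assms, of v "concat vs"] T(3) by (auto simp: U_def)
  moreover have "card (T \<union> U) \<le> length (v # vs) * m"
    using card_Un_le[of T U] T U by simp
  ultimately show ?case using T(1) U(1) by blast
qed

text \<open>Descending through the rules, each factor ends up straddling a boundary in some
  right-hand side. A rule of length \<open>l\<close> is charged for at most \<open>l * m\<close> of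
  them.\<close>

lemma card_factors_val_le:
  assumes "is_slp G" "2 \<le> m"
  shows "card (factors m (val G)) \<le> slp_size G * m"
proof -
  obtain f where f: "interprets f G" using exists_interpretation[OF assms(1)] by blast
  have "0 < m" using assms(2) by simp
  let ?N = "nonterminals G"
  let ?vs = "\<lambda>A. map (case_sum f (\<lambda>a. [a])) (rhs G A)"
  have "\<forall>A. \<exists>T. finite T \<and> card T \<le> length (?vs A) * m \<and>
    factors m (concat (?vs A)) \<subseteq> (\<Union>v\<in>set (?vs A). factors m v) \<union> T"
    by (intro allI factors_concat \<open>0 < m\<close>)
  then obtain T where T: "\<And>A. finite (T A)" "\<And>A. card (T A) \<le> length (rhs G A) * m"
    "\<And>A. factors m (concat (?vs A)) \<subseteq> (\<Union>v\<in>set (?vs A). factors m v) \<union> T A"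
    unfolding length_map by metis
  have sub: "factors m (f A) \<subseteq> (\<Union>B\<in>?N. T B)" if "A \<in> ?N" for A
    using wf_occurs_in[OF assms(1)] that
  proof (induction A)
    case (less A)
    have "f A = concat (?vs A)"
      using f assms(1) less.prems by (simp add: interprets_iff_rhs expand_def)
    then have *: "factors m (f A) \<subseteq> (\<Union>v\<in>set (?vs A). factors m v) \<union> T A"
      using T(3)[of A] by simp
    have "factors m (case_sum f (\<lambda>a. [a]) s) \<subseteq> (\<Union>B\<in>?N. T B)" if "s \<in> set (rhs G A)" for s
    proof (cases s)
      case (Inl B)
      with that less.IH rhs_props[OF assms(1) less.prems] show ?thesis by simp
    next
      \<comment> \<open>A single letter has no factor of length \<open>m\<close>, since
        \<open>m\<close> is at least 2.\<close>
      case (Inr a)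
      with assms(2) show ?thesis by (auto simp: factors_def)
    qed
    with * less.prems show ?case by fastforce
  qed
  have N: "start G \<in> ?N" "finite ?N" using assms(1) by (auto simp: is_slp_def)
  have "card (factors m (val G)) \<le> card (\<Union>B\<in>?N. T B)"
    using sub[OF N(1)] val_eq_interpretation[OF assms(1) f] N(2) T(1)
    by (intro card_mono) auto
  also have "\<dots> \<le> (\<Sum>B\<in>?N. card (T B))" by (rule card_UN_le[OF N(2)])
  also have "\<dots> \<le> (\<Sum>B\<in>?N. length (rhs G B) * m)" by (intro sum_mono T)
  also have "\<dots> = slp_size G * m"
    by (simp add: slp_size_eq_rhs[OF assms(1)] sum_distrib_right)
  finally show ?thesis .
qed

lemma length_le_two_power_g:
  fixes w :: "'a list"
  assumes "w \<noteq> []"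
  shows "length w \<le> 2 ^ g w"
proof -
  obtain G :: "(nat, 'a) grammar" where "is_slp G" "val G = w" "slp_size G = g w"
    by (rule g_attained[OF assms])
  then show ?thesis using length_val_le[of G] by simp
qed

lemma card_factors_le_g:
  fixes w :: "'a list"
  assumes "w \<noteq> []" "2 \<le> m"
  shows "card (factors m w) \<le> g w * m"
proof -
  obtain G :: "(nat, 'a) grammar" where "is_slp G" "val G = w" "slp_size G = g w"
    by (rule g_attained[OF assms(1)])
  then show ?thesis using card_factors_val_le[of G m] assms(2) by simp
qed

subsection \<open>The upper bound\<close>

lemma split_exponent_eqI:
  assumes "2 ^ j < m" "m \<le> 2 ^ (j + 1)"
  shows "split_exponent m = j"
  unfolding split_exponent_def
proof (rule the_equality)
  fix i assume i: "2 ^ i < m \<and> m \<le> 2 ^ (i + 1)"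
  have "(2::nat) ^ i < 2 ^ (j + 1)" "(2::nat) ^ j < 2 ^ (i + 1)"
    using i assms by linarith+
  from this[THEN power_less_imp_less_exp[rotated]] show "i = j" by simp
qed (use assms in simp)

lemma split_exponent:
  assumes "2 \<le> m"
  shows "2 ^ split_exponent m < m" "m \<le> 2 ^ (split_exponent m + 1)"
proof -
  \<comment> \<open>Minimality of \<open>j\<close> gives the strict lower bound; for
    \<open>j = 0\<close> that bound is just \<open>1 < m\<close>.\<close>
  define j where "j = (LEAST j. m \<le> 2 ^ (j + 1))"
  have "m \<le> 2 ^ (m + 1)"
    using less_exp[of "m + 1"] by linarith
  then have j: "m \<le> 2 ^ (j + 1)" unfolding j_def by (rule LeastI)
  have "2 ^ j < m"
  proof (cases j)
    case (Suc i)
    then have "i < (LEAST j. m \<le> 2 ^ (j + 1))" unfolding j_def by linarith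
    from not_less_Least[OF this] have "2 ^ (i + 1) < m" by (simp only: not_le)
    with Suc show ?thesis by simp
  qed (use assms in simp)
  with j show "2 ^ split_exponent m < m" "m \<le> 2 ^ (split_exponent m + 1)"
    using split_exponent_eqI by auto
qed

text \<open>\<open>take\<close> silently truncates the last block, and the strict inequality
  excludes empty blocks.\<close>

definition aligned_blocks :: "nat \<Rightarrow> 'a list \<Rightarrow> 'a list set" where
  "aligned_blocks i w = {take (2 ^ i) (drop (q * 2 ^ i) w) | q. q * 2 ^ i < length w}"

text \<open>Both parts of an aligned block are aligned at level \<open>s\<close>, the split exponent
  of its actual length. For a full block \<open>s = i - 1\<close>; a truncated one may fall several
  levels at once.\<close>

lemma bisection_words_subset_blocks:
  assumes "2 \<le> length w"
  shows "bisection_words w \<subseteq> (\<Union>i\<le>split_exponent (length w) + 1. aligned_blocks i w)"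
proof
  let ?M = "split_exponent (length w) + 1"
  fix v assume "v \<in> bisection_words w"
  then have "\<exists>i q. i \<le> ?M \<and> q * 2 ^ i < length w \<and> v = take (2 ^ i) (drop (q * 2 ^ i) w)"
  proof induction
    case 1
    show ?case
      by (rule exI[of _ ?M], rule exI[of _ 0]) (use assms split_exponent(2)[OF assms] in auto)
  next
    case (2 v)
    then obtain i q where iq: "i \<le> ?M" "q * 2 ^ i < length w"
      "v = take (2 ^ i) (drop (q * 2 ^ i) w)" by blast
    define s where "s = split_exponent (length v)"
    have "2 ^ s < (2::nat) ^ i" using split_exponent(1)[OF 2(2)] iq(3) by (simp add: s_def)
    then have s: "s < i" "(2::nat) ^ s \<le> 2 ^ i" by simp_all
    then have pw: "q * 2 ^ (i - s) * 2 ^ s = q * 2 ^ i" by (simp add: mult.assoc flip: power_add)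
    have "left_part v = take (2 ^ s) v" by (simp add: left_part_def s_def)
    also have "\<dots> = take (2 ^ s) (drop (q * 2 ^ (i - s) * 2 ^ s) w)"
      unfolding pw using s(2) by (subst iq(3)) (simp add: min_absorb1)
    finally have "left_part v = take (2 ^ s) (drop (q * 2 ^ (i - s) * 2 ^ s) w)" .
    moreover have "q * 2 ^ (i - s) * 2 ^ s < length w" using iq(2) by (simp only: pw)
    moreover have "s \<le> ?M" using s(1) iq(1) by simp
    ultimately show ?case by metis
  next
  case (3 v)
    then obtain i q where iq: "i \<le> ?M" "q * 2 ^ i < length w"
      "v = take (2 ^ i) (drop (q * 2 ^ i) w)" by blast
    define s where "s = split_exponent (length v)"
    have len: "2 ^ s < length v" "length v \<le> 2 ^ (s + 1)"
      using split_exponent[OF 3(2)] by (simp_all add: s_def)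
    then have "2 ^ s < (2::nat) ^ i" using iq(3) by simp
    then have s: "s < i" by simp
    let ?q = "q * 2 ^ (i - s) + 1"
    have q: "?q * 2 ^ s = 2 ^ s + q * 2 ^ i"
      using s by (simp add: add_mult_distrib mult.assoc flip: power_add)
    have "(2::nat) ^ (s + 1) \<le> 2 ^ i" using s by (intro power_increasing) auto
    then have le: "2 ^ s \<le> (2::nat) ^ i - 2 ^ s" by simp
    have right: "right_part v = drop (2 ^ s) v" by (simp add: right_part_def s_def)
    also have "\<dots> = take (2 ^ i - 2 ^ s) (drop (?q * 2 ^ s) w)"
      unfolding q by (subst iq(3)) (simp add: drop_take)
    finally have "take (2 ^ s) (right_part v) = take (2 ^ s) (drop (?q * 2 ^ s) w)"
      using le by (simp add: min_absorb1)
    \<comment> \<open>The right part has at most \<open>2 ^ s\<close> letters, so cutting at the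
      block length of level \<open>s\<close> loses nothing.\<close>
    moreover have "take (2 ^ s) (right_part v) = right_part v"
      using len(2) right by simp
    moreover have "?q * 2 ^ s < length w"
    proof -
      have "2 ^ s < length w - q * 2 ^ i" using len(1) iq(3) by simp
      then show ?thesis unfolding q by linarith
    qed
    moreover have "s \<le> ?M" using s iq(1) by simp
    ultimately show ?case by metis
  qed
  then show "v \<in> (\<Union>i\<le>?M. aligned_blocks i w)" by (auto simp: aligned_blocks_def)
qed

text \<open>Only the last block can be truncated, and it starts at index
  \<open>(length w - 1) div 2 ^ i\<close>. All full blocks are factors with index below
  \<open>length w div 2 ^ i\<close>.\<close>

lemma aligned_blocks_subset:
  "aligned_blocks i w \<subseteq> insert (drop ((length w - 1) div 2 ^ i * 2 ^ i) w)
     (factors (2 ^ i) w \<inter> (\<lambda>q. take (2 ^ i) (drop (q * 2 ^ i) w)) ` {..<length w div 2 ^ i})"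
proof
  fix v assume "v \<in> aligned_blocks i w"
  then obtain q where q: "q * 2 ^ i < length w" "v = take (2 ^ i) (drop (q * 2 ^ i) w)"
    by (auto simp: aligned_blocks_def)
  show "v \<in> insert (drop ((length w - 1) div 2 ^ i * 2 ^ i) w)
     (factors (2 ^ i) w \<inter> (\<lambda>q. take (2 ^ i) (drop (q * 2 ^ i) w)) ` {..<length w div 2 ^ i})"
  proof (cases "q * 2 ^ i + 2 ^ i \<le> length w")
    case True
    then have "Suc q \<le> length w div 2 ^ i" by (subst less_eq_div_iff_mult_less_eq) auto
    with True q show ?thesis by (auto simp: factors_def)
  next
    case False
    have "(length w - 1) div 2 ^ i = q"
      using False q(1) by (intro div_nat_eqI) (auto simp: algebra_simps)
    with False q show ?thesis by simp
  qed
qed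

text \<open>Full blocks are bounded both by the number of distinct factors and by the number of
  positions; the summand 1 pays for the truncated block.\<close>

lemma card_aligned_blocks_le:
  assumes "w \<noteq> []" "1 \<le> i"
  shows "finite (aligned_blocks i w)"
    "card (aligned_blocks i w) \<le> 1 + min (g w * 2 ^ i) (length w div 2 ^ i)"
proof -
  let ?F = "factors (2 ^ i) w \<inter> (\<lambda>q. take (2 ^ i) (drop (q * 2 ^ i) w)) ` {..<length w div 2 ^ i}"
  let ?x = "drop ((length w - 1) div 2 ^ i * 2 ^ i) w"
  have fin: "finite ?F" by (simp add: finite_factors)
  show "finite (aligned_blocks i w)"
    by (rule finite_subset[OF aligned_blocks_subset]) (use fin in simp)
  have "(2::nat) ^ 1 \<le> 2 ^ i" using assms(2) by (intro power_increasing) auto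
  then have "card (factors (2 ^ i) w) \<le> g w * 2 ^ i" by (intro card_factors_le_g assms(1)) simp
  moreover have "card ?F \<le> card (factors (2 ^ i) w)" by (intro card_mono finite_factors) auto
  moreover have "card ?F \<le> length w div 2 ^ i"
    by (rule order.trans[OF card_mono card_image_le[of "{..<length w div 2 ^ i}", simplified]]) auto
  ultimately have "card ?F \<le> min (g w * 2 ^ i) (length w div 2 ^ i)" by simp
  moreover have "card (aligned_blocks i w) \<le> card (insert ?x ?F)"
    by (rule card_mono[OF _ aligned_blocks_subset]) (use fin in simp)
  moreover have "card (insert ?x ?F) \<le> 1 + card ?F" using fin by (simp add: card_insert_if)
  ultimately show "card (aligned_blocks i w) \<le> 1 + min (g w * 2 ^ i) (length w div 2 ^ i)" by linarith
qed

lemma slp_size_bisection: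
  assumes "2 \<le> length w"
  shows "slp_size (bisection w) = 2 * card {v \<in> bisection_words w. 2 \<le> length v}"
proof -
  let ?N = "{v \<in> bisection_words w. 2 \<le> length v}"
  let ?r = "\<lambda>v. (v, [word_symbol (left_part v), word_symbol (right_part v)])"
  have "productions (bisection w) = ?r ` ?N"
    using assms by (auto simp: bisection_def)
  then have "slp_size (bisection w) = (\<Sum>(A, u)\<in>?r ` ?N. length u)" by (simp add: slp_size_def)
  also have "\<dots> = (\<Sum>v\<in>?N. 2)" by (subst sum.reindex) (auto simp: inj_on_def)
  finally show ?thesis by simp
qed

lemma finite_bisection_words:
  assumes "2 \<le> length w"
  shows "finite {v \<in> bisection_words w. 2 \<le> length v}"
    "{v \<in> bisection_words w. 2 \<le> length v} \<subseteq> (\<Union>i\<in>{1..split_exponent (length w) + 1}. aligned_blocks i w)"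
proof -
  have ne: "w \<noteq> []" using assms by auto
  show *: "{v \<in> bisection_words w. 2 \<le> length v} \<subseteq> (\<Union>i\<in>{1..split_exponent (length w) + 1}. aligned_blocks i w)"
  proof
    fix v assume v: "v \<in> {v \<in> bisection_words w. 2 \<le> length v}"
    then obtain i where i: "i \<le> split_exponent (length w) + 1" "v \<in> aligned_blocks i w"
      using bisection_words_subset_blocks[OF assms] by blast
    \<comment> \<open>Level 0 yields only single letters, so the sum can start at level 1, where the
      factor bound applies.\<close>
    have "i \<noteq> 0"
    proof
      assume "i = 0"
      with i(2) have "length v \<le> 1" by (auto simp: aligned_blocks_def)
      with v show False by simp
    qed
    with i show "v \<in> (\<Union>i\<in>{1..split_exponent (length w) + 1}. aligned_blocks i w)" by fastforce
  qed
  show "finite {v \<in> bisection_words w. 2 \<le> length v}"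
    by (rule finite_subset[OF *]) (use ne card_aligned_blocks_le(1) in auto)
qed

lemma card_bisection_words_le:
  assumes "2 \<le> length w"
  shows "card {v \<in> bisection_words w. 2 \<le> length v} \<le>
    (\<Sum>i=1..split_exponent (length w) + 1. 1 + min (g w * 2 ^ i) (length w div 2 ^ i))"
proof -
  let ?I = "{1..split_exponent (length w) + 1}"
  have ne: "w \<noteq> []" using assms by auto
  have "card {v \<in> bisection_words w. 2 \<le> length v} \<le> card (\<Union>i\<in>?I. aligned_blocks i w)"
    by (intro card_mono finite_bisection_words assms) (use ne card_aligned_blocks_le(1) in auto)
  also have "\<dots> \<le> (\<Sum>i\<in>?I. card (aligned_blocks i w))" by (rule card_UN_le) simp
  also have "\<dots> \<le> (\<Sum>i\<in>?I. 1 + min (g w * 2 ^ i) (length w div 2 ^ i))"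
    using card_aligned_blocks_le(2)[OF ne] by (intro sum_mono) auto
  finally show ?thesis .
qed

section \<open>Summation over the levels\<close>

lemma sum_min_geometric_le:
  fixes a n :: real
  assumes "0 \<le> a" "0 \<le> n"
  shows "(\<Sum>i=1..M. min (a * 2 ^ i) (n / 2 ^ i)) \<le> a * 2 ^ (t + 1) + n / 2 ^ t"
proof -
  let ?S = "\<lambda>M. \<Sum>i=1..M. min (a * 2 ^ i) (n / 2 ^ i)"
  have A: "?S M \<le> a * 2 ^ (M + 1)" for M
  proof (induction M)
    case (Suc M)
    have "?S (Suc M) \<le> a * 2 ^ (M + 1) + a * 2 ^ (M + 1)"
      using Suc by (simp add: min.coboundedI1 add_mono)
    then show ?case by simp
  qed (use assms in simp)
  \<comment> \<open>Beyond the cut \<open>t\<close> the decreasing bound is used; subtracting the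
    last term makes the induction telescope.\<close>
  have B: "?S (t + d) \<le> a * 2 ^ (t + 1) + n / 2 ^ t - n / 2 ^ (t + d)" for d
  proof (induction d)
    case 0
    then show ?case using A[of t] by simp
  next
    case (Suc d)
    have "?S (t + Suc d) \<le> ?S (t + d) + n / 2 ^ (t + Suc d)" by simp
    moreover have "n / 2 ^ (t + d) = n / 2 ^ (t + Suc d) + n / 2 ^ (t + Suc d)" by simp
    ultimately show ?case using Suc by linarith
  qed
  show ?thesis
  proof (cases "M \<le> t")
    case True
    have "?S M \<le> a * 2 ^ (M + 1)" by (rule A)
    also have "\<dots> \<le> a * 2 ^ (t + 1)"
      using assms(1) True by (intro mult_left_mono power_increasing) auto
    finally show ?thesis using assms(2) by (simp add: add_increasing2)
  next
    case False
    then have "?S M \<le> a * 2 ^ (t + 1) + n / 2 ^ t - n / 2 ^ M" using B[of "M - t"] by simp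
    moreover have "0 \<le> n / 2 ^ M" using assms(2) by simp
    ultimately show ?thesis by linarith
  qed
qed

lemma sum_min_geometric_le_sqrt:
  fixes a n :: nat
  assumes "1 \<le> a" "a \<le> n"
  shows "(\<Sum>i=1..M. min (real a * 2 ^ i) (real n / 2 ^ i)) \<le> 4 * sqrt (real n * real a)"
proof -
  \<comment> \<open>Chosen so that \<open>a * 4 ^ t \<le> n < a * 4 ^ (t + 1)\<close>: then
    \<open>2 ^ t\<close> is within a factor 2 of \<open>sqrt (n / a)\<close>, and each of the two
    terms is at most \<open>2 * sqrt (n * a)\<close>.\<close>
  define t where "t = (LEAST t. n < a * 4 ^ (t + 1))"
  have "n < 4 ^ (n + 1)" using less_exp[of "n + 1"] power_mono[of 2 "4::nat" "n + 1"] by linarith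
  also have "\<dots> \<le> a * 4 ^ (n + 1)" using assms(1) by simp
  finally have t1: "n < a * 4 ^ (t + 1)" unfolding t_def by (rule LeastI)
  have t2: "a * 4 ^ t \<le> n"
  proof (cases t)
    case (Suc i)
    then have "i < (LEAST t. n < a * 4 ^ (t + 1))" unfolding t_def by linarith
    from not_less_Least[OF this] show ?thesis by (simp add: Suc not_less)
  qed (use assms in simp)
  have four: "(4::real) ^ t = 2 ^ t * 2 ^ t" by (simp flip: power_mult_distrib)
  have a: "real a * 2 ^ t \<le> sqrt (real n * real a)"
  proof (rule real_le_rsqrt)
    have "real (a * 4 ^ t) \<le> real n" using t2 by (simp only: of_nat_le_iff)
    then have "real a * (real a * 4 ^ t) \<le> real a * real n" by (intro mult_left_mono) auto
    then show "(real a * 2 ^ t)\<^sup>2 \<le> real n * real a"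
      by (simp add: four power2_eq_square mult_ac)
  qed
  have "real n / 2 ^ t \<le> sqrt (4 * (real n * real a))"
  proof (rule real_le_rsqrt)
    have "real n \<le> real (a * 4 ^ (t + 1))" using t1 by (simp only: of_nat_le_iff)
    then have "real n * real n \<le> real n * (4 * real a * 4 ^ t)" by (intro mult_left_mono) auto
    then show "(real n / 2 ^ t)\<^sup>2 \<le> 4 * (real n * real a)"
      by (simp add: four power2_eq_square field_simps)
  qed
  also have "\<dots> = 2 * sqrt (real n * real a)" by (simp add: real_sqrt_mult)
  finally have "real a * 2 ^ (t + 1) + real n / 2 ^ t \<le> 4 * sqrt (real n * real a)"
    using a by simp
  with sum_min_geometric_le[of "real a" "real n" M t] show ?thesis by simp
qed

lemma bisection_ratio_le:
  assumes "2 \<le> length w"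
  shows "real (slp_size (bisection w)) / real (g w)
    \<le> 10 * sqrt (real (length w) / log 2 (real (length w)))"
proof -
  define n where "n = length w"
  define M where "M = split_exponent n + 1"
  have ne: "w \<noteq> []" using assms by auto
  have n2: "2 \<le> n" using assms by (simp add: n_def)
  have exp_g: "n \<le> 2 ^ g w" using length_le_two_power_g[OF ne] by (simp add: n_def)
  have gn: "g w \<le> n" using g_le_length[OF ne] by (simp add: n_def)
  have g1: "1 \<le> g w" using exp_g n2 by (cases "g w") auto
  have log_pos: "0 < log 2 (real n)" using n2 by simp
  have "real n \<le> 2 ^ g w" using exp_g by (metis of_nat_le_iff of_nat_numeral of_nat_power)
  then have log_g: "log 2 (real n) \<le> real (g w)"
    using n2 by (simp add: log_le_iff powr_realpow)
  \<comment> \<open>There are at most \<open>g w\<close> levels, so the truncated blocks together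
    cost at most \<open>g w\<close>.\<close>
  have "(2::nat) ^ split_exponent n < 2 ^ g w" using split_exponent(1)[OF n2] exp_g by linarith
  then have "M \<le> g w" by (simp add: M_def)
  have "real (card {v \<in> bisection_words w. 2 \<le> length v})
      \<le> real (\<Sum>i=1..M. 1 + min (g w * 2 ^ i) (n div 2 ^ i))"
    using card_bisection_words_le[OF assms] by (simp only: of_nat_le_iff M_def n_def)
  also have "\<dots> = (\<Sum>i=1..M. 1 + real (min (g w * 2 ^ i) (n div 2 ^ i)))"
    by (simp only: of_nat_sum of_nat_add of_nat_1)
  also have "\<dots> \<le> (\<Sum>i=1..M. 1 + min (real (g w) * 2 ^ i) (real n / 2 ^ i))"
  proof (intro sum_mono add_left_mono)
    fix i
    have "real (n div 2 ^ i) \<le> real n / 2 ^ i"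
      using of_nat_div_le_of_nat[of n "2 ^ i", where ?'a = real] by simp
    then show "real (min (g w * 2 ^ i) (n div 2 ^ i)) \<le> min (real (g w) * 2 ^ i) (real n / 2 ^ i)"
      unfolding of_nat_min by (intro min.mono) simp_all
  qed
  also have "\<dots> = real M + (\<Sum>i=1..M. min (real (g w) * 2 ^ i) (real n / 2 ^ i))"
    by (simp add: sum.distrib)
  also have "\<dots> \<le> real (g w) + 4 * sqrt (real n * real (g w))"
    using sum_min_geometric_le_sqrt[OF g1 gn, of M] \<open>M \<le> g w\<close> by simp
  finally have size: "real (slp_size (bisection w)) \<le> 2 * real (g w) + 8 * sqrt (real n * real (g w))"
    by (simp add: slp_size_bisection[OF assms])
  have "real (slp_size (bisection w)) / real (g w)
      \<le> (2 * real (g w) + 8 * sqrt (real n * real (g w))) / real (g w)"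
    using size by (intro divide_right_mono) auto
  \<comment> \<open>Written this way, the square root releases a factor \<open>g w\<close> that
    cancels the denominator.\<close>
  also have "real n * real (g w) = (real n / real (g w)) * (real (g w))\<^sup>2"
    using g1 by (simp add: power2_eq_square)
  also have "(2 * real (g w) + 8 * sqrt \<dots>) / real (g w) = 2 + 8 * sqrt (real n / real (g w))"
    unfolding real_sqrt_mult using g1 by (simp add: add_divide_distrib)
  \<comment> \<open>The additive 2 is absorbed because \<open>n / log n\<close> is at least 1; the
    root grows when \<open>g w\<close> is replaced by its lower bound \<open>log n\<close>.\<close>
  also have "\<dots> \<le> 2 * sqrt (real n / log 2 (real n)) + 8 * sqrt (real n / log 2 (real n))"
  proof (intro add_mono mult_left_mono)
    have "log 2 (real n) \<le> real n" using log_g gn by linarith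
    then have "1 \<le> real n / log 2 (real n)" using log_pos by simp
    then have "1 \<le> sqrt (real n / log 2 (real n))" by simp
    then show "2 \<le> 2 * sqrt (real n / log 2 (real n))" by simp
    show "sqrt (real n / real (g w)) \<le> sqrt (real n / log 2 (real n))"
      using log_pos log_g by (intro real_sqrt_le_mono divide_left_mono) auto
  qed auto
  also have "\<dots> = 10 * sqrt (real n / log 2 (real n))" by simp
  finally show ?thesis by (simp add: n_def)
qed

subsection \<open>The lower bound\<close>

text \<open>A word whose length is a power of two is always halved exactly, so here every aligned
  block does arise.\<close>

lemma aligned_block_in_bisection_words:
  assumes "v \<in> bisection_words w" "length v = 2 ^ (i + d)" "q < 2 ^ d"
  shows "take (2 ^ i) (drop (q * 2 ^ i) v) \<in> bisection_words w"
  using assms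
proof (induction d arbitrary: v q)
  case (Suc d)
  have len: "length v = 2 ^ (i + d) + 2 ^ (i + d)" using Suc.prems(2) by simp
  have pos: "(1::nat) \<le> 2 ^ (i + d)" by simp
  have len2: "2 \<le> length v" using len pos by linarith
  have split: "split_exponent (length v) = i + d"
    by (rule split_exponent_eqI) (simp_all add: len)
  have l: "left_part v \<in> bisection_words w" "length (left_part v) = 2 ^ (i + d)"
    and r: "right_part v \<in> bisection_words w" "length (right_part v) = 2 ^ (i + d)"
    using bisection_words.intros(2,3)[OF Suc.prems(1) len2] split len
    by (auto simp: left_part_def right_part_def)
  show ?case
  \<comment> \<open>The leading binary digit of \<open>q\<close> decides in which half the block
    lies.\<close>
  proof (cases "q < 2 ^ d")
    case True
    then have "(q + 1) * 2 ^ i \<le> 2 ^ d * 2 ^ i" by (intro mult_right_mono) auto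
    then have "q * 2 ^ i + 2 ^ i \<le> 2 ^ (i + d)" by (simp add: power_add mult.commute)
    then have "take (2 ^ i) (drop (q * 2 ^ i) (left_part v)) = take (2 ^ i) (drop (q * 2 ^ i) v)"
      by (simp add: left_part_def split drop_take min_def)
    with Suc.IH[OF l True] show ?thesis by simp
  next
    case False
    then have q: "q - 2 ^ d < 2 ^ d" using Suc.prems(3) by auto
    have "(q - 2 ^ d) * 2 ^ i + 2 ^ (i + d) = (q - 2 ^ d + 2 ^ d) * 2 ^ i"
      by (simp only: power_add algebra_simps)
    then have "drop ((q - 2 ^ d) * 2 ^ i) (right_part v) = drop (q * 2 ^ i) v"
      using False by (simp add: right_part_def split)
    with Suc.IH[OF r q] show ?thesis by simp
  qed
qed simp

lemma take_drop_concat_blocks: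
  assumes "\<And>u. u \<in> set us \<Longrightarrow> length u = m" "q < length us"
  shows "take m (drop (q * m) (concat us @ z)) = us ! q"
  using assms
proof (induction us arbitrary: q)
  case (Cons u us)
  then show ?case by (cases q) (auto simp: add.commute)
qed simp

text \<open>The first split isolates a prefix of length \<open>2 ^ split_exponent n\<close>. All
  blocks in \<open>us\<close> fit into it, and each distinct one costs a rule with two
  symbols.\<close>

lemma card_blocks_le_bisection:
  assumes "length w = n" "2 \<le> n" "w = concat us @ z" "1 \<le> b"
    and "\<And>u. u \<in> set us \<Longrightarrow> length u = 2 ^ b"
    and "length us * 2 ^ b \<le> 2 ^ split_exponent n"
  shows "2 * card (set us) \<le> slp_size (bisection w)"
proof -
  let ?J = "split_exponent n"
  have len: "2 \<le> length w" using assms by simp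
  have "set us \<subseteq> {v \<in> bisection_words w. 2 \<le> length v}"
  proof
    fix u assume "u \<in> set us"
    then obtain q where q: "q < length us" "us ! q = u" by (auto simp: in_set_conv_nth)
    have le: "(q + 1) * 2 ^ b \<le> 2 ^ ?J"
      using q(1) by (intro order.trans[OF mult_right_mono assms(6)]) auto
    have "(2::nat) ^ b \<le> 2 ^ ?J" by (rule order.trans[OF _ le]) simp
    then have b: "b \<le> ?J" by simp
    have left: "left_part w = take (2 ^ ?J) w" by (simp add: left_part_def assms(1))
    have "q < 2 ^ (?J - b)"
    proof -
      have "q * 2 ^ b < (q + 1) * 2 ^ b" by simp
      also note le
      also have "(2::nat) ^ ?J = 2 ^ (?J - b) * 2 ^ b" using b by (simp flip: power_add)
      finally show ?thesis by simp
    qed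
    moreover have "left_part w \<in> bisection_words w"
      by (intro bisection_words.intros len)
    moreover have "length (left_part w) = 2 ^ (b + (?J - b))"
      using split_exponent(1)[OF assms(2)] b by (simp add: left assms(1))
    ultimately have "take (2 ^ b) (drop (q * 2 ^ b) (left_part w)) \<in> bisection_words w"
      by (intro aligned_block_in_bisection_words)
    also have "take (2 ^ b) (drop (q * 2 ^ b) (left_part w)) = take (2 ^ b) (drop (q * 2 ^ b) w)"
      using le by (simp add: left drop_take min_def)
    also have "\<dots> = u"
      using take_drop_concat_blocks[of us "2 ^ b" q z] assms(3,5) q by simp
    finally have "u \<in> bisection_words w" .
    moreover have "(2::nat) ^ 1 \<le> 2 ^ b" using assms(4) by (intro power_increasing) auto
    ultimately show "u \<in> {v \<in> bisection_words w. 2 \<le> length v}"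
      using assms(5)[OF \<open>u \<in> set us\<close>] by simp
  qed
  then have "card (set us) \<le> card {v \<in> bisection_words w. 2 \<le> length v}"
    by (intro card_mono finite_bisection_words len)
  then show ?thesis by (simp add: slp_size_bisection[OF len])
qed

section \<open>The hard words for BISECTION and their aligned blocks\<close>

definition shifted_block :: "'a \<Rightarrow> 'a \<Rightarrow> nat \<Rightarrow> nat \<Rightarrow> nat \<Rightarrow> 'a list" where
  "shifted_block x y m r j = replicate r x @ replicate j y @ replicate (m - j - r) x"

definition period_word :: "'a \<Rightarrow> 'a \<Rightarrow> nat \<Rightarrow> nat \<Rightarrow> 'a list" where
  "period_word x y m l = concat (map (\<lambda>j. replicate j y @ replicate (m - j) x) [1..<Suc l]) @ [x]"

definition shifted_blocks :: "'a \<Rightarrow> 'a \<Rightarrow> nat \<Rightarrow> nat \<Rightarrow> nat \<Rightarrow> 'a list list" where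
  "shifted_blocks x y m l k =
    concat (map (\<lambda>r. map (shifted_block x y m r) [1..<Suc l]) [0..<k])"

text \<open>Each block ends in at least \<open>r\<close> letters \<open>x\<close>, so a prefix of
  \<open>r\<close> such letters can be handed on from block to block until it emerges at the
  end.\<close>

lemma replicate_append_period:
  assumes "r + l \<le> m"
  shows "replicate r x @ concat (map (\<lambda>j. replicate j y @ replicate (m - j) x) [1..<Suc l]) =
    concat (map (shifted_block x y m r) [1..<Suc l]) @ replicate r x"
  using assms
proof (induction l)
  case (Suc l)
  have "replicate (m - Suc l) x = replicate (m - Suc l - r) x @ replicate r x"
    using Suc.prems by (simp flip: replicate_add)
  with Suc show ?case by (simp add: shifted_block_def)
qed simp

lemma concat_replicate_period:
  assumes "k + l \<le> m"
  shows "concat (replicate k (period_word x y m l)) =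
    concat (shifted_blocks x y m l k) @ replicate k x"
  using assms
proof (induction k)
  case (Suc k)
  have "concat (replicate (Suc k) (period_word x y m l)) =
      concat (replicate k (period_word x y m l)) @ period_word x y m l"
    by (simp flip: replicate_append_same)
  also have "\<dots> = concat (shifted_blocks x y m l k) @ (replicate k x @ period_word x y m l)"
    using Suc by simp
  also have "replicate k x @ period_word x y m l =
      (concat (map (shifted_block x y m k) [1..<Suc l]) @ replicate k x) @ [x]"
    using replicate_append_period[of k l m x y] Suc.prems
    by (simp add: period_word_def del: upt_Suc flip: append_assoc)
  \<comment> \<open>The final \<open>x\<close> of the period joins the \<open>k\<close> letters
    carried along, so the next copy is shifted by \<open>k + 1\<close>.\<close>
  also have "\<dots> = concat (map (shifted_block x y m k) [1..<Suc l]) @ replicate (Suc k) x"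
    by (simp add: replicate_append_same)
  finally show ?case by (simp add: shifted_blocks_def upt_Suc[of 0 k] del: upt_Suc)
qed (simp add: shifted_blocks_def)

lemma length_period_word:
  assumes "l \<le> m"
  shows "length (period_word x y m l) = l * m + 1"
  using assms unfolding period_word_def by (induction l) auto

lemma set_shifted_blocks:
  "set (shifted_blocks x y m l k) = (\<lambda>(r, j). shifted_block x y m r j) ` ({..<k} \<times> {1..l})"
  by (force simp: shifted_blocks_def)

lemma length_shifted_blocks: "length (shifted_blocks x y m l k) = k * l"
  unfolding shifted_blocks_def by (induction k) auto

lemma length_shifted_block:
  "r + j \<le> m \<Longrightarrow> length (shifted_block x y m r j) = m"
  by (simp add: shifted_block_def)

text \<open>From the block, \<open>j\<close> is recovered as the number of letters \<open>y\<close>,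
  and \<open>r\<close> as the length of the initial run of \<open>x\<close>, which ends at a
  \<open>y\<close> because \<open>j\<close> is at least 1.\<close>

lemma inj_shifted_block:
  assumes "x \<noteq> y"
  shows "inj_on (\<lambda>(r, j). shifted_block x y m r j) ({..<k} \<times> {1..l})"
proof (rule inj_onI, clarify)
  fix r j r' j'
  assume eq: "shifted_block x y m r j = shifted_block x y m r' j'"
    and j: "j \<in> {1..l}" "j' \<in> {1..l}"
  have cnt: "filter ((=) y) (shifted_block x y m r j) = replicate j y" for r j
    using assms by (simp add: shifted_block_def filter_replicate)
  have tw: "length (takeWhile ((=) x) (shifted_block x y m r j)) = r" if "1 \<le> j" for r j
    using assms that by (cases j) (simp_all add: shifted_block_def takeWhile_append)
  have "replicate j y = replicate j' y" using eq cnt by metis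
  then show "r = r' \<and> j = j'" using eq tw j by (metis atLeastAtMost_iff length_replicate)
qed

lemma card_shifted_blocks:
  assumes "x \<noteq> y"
  shows "card (set (shifted_blocks x y m l k)) = k * l"
  unfolding set_shifted_blocks card_image[OF inj_shifted_block[OF assms]] by simp

section \<open>Small straight-line programs for powers and for the hard words\<close>

text \<open>Repeated squaring: each binary digit of \<open>k\<close> after the first costs one rule
  with at most three symbols.\<close>

lemma straight_line_powers:
  assumes "straight_line S m" "v \<in> S \<or> length v = 1" "1 \<le> k" "k < 2 ^ t"
  shows "\<exists>S' m'. straight_line S' m' \<and> S \<subseteq> S' \<and> m' \<le> m + 3 * t \<and>
    (concat (replicate k v) \<in> S' \<or> length (concat (replicate k v)) = 1)"
  using assms(3,4)
proof (induction t arbitrary: k)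
  case (Suc t)
  show ?case
  proof (cases "k = 1")
    case True
    with assms show ?thesis by (intro exI[of _ S] exI[of _ m]) auto
  next
    case False
    let ?p = "concat (replicate (k div 2) v)"
    have "1 \<le> k div 2" "k div 2 < 2 ^ t" using Suc.prems False by auto
    from Suc.IH[OF this] obtain S' m' where S': "straight_line S' m'" "S \<subseteq> S'"
      "m' \<le> m + 3 * t" "?p \<in> S' \<or> length ?p = 1" by blast
    define us where "us = [?p, ?p] @ (if even k then [] else [v])"
    have sum: "k div 2 + (k div 2 + k mod 2) = k" by presburger
    have "concat us = concat (replicate (k div 2 + (k div 2 + k mod 2)) v)"
      unfolding replicate_add us_def by (cases "even k") (simp_all add: mod2_eq_if)
    then have cc: "concat us = concat (replicate k v)" by (simp only: sum)
    have "straight_line (insert (concat us) S') (m' + length us)"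
      using S' assms(2) by (intro straight_line.intros) (auto simp: us_def split: if_splits)
    moreover have "m' + length us \<le> m + 3 * Suc t" using S'(3) by (simp add: us_def)
    ultimately show ?thesis using S'(2) unfolding cc by blast
  qed
qed simp

lemma concat_replicate_singleton: "concat (replicate k [x]) = replicate k x"
  by (induction k) auto

lemma straight_line_replicate:
  assumes "straight_line S m" "1 \<le> k" "k < 2 ^ t"
  shows "\<exists>S' m'. straight_line S' m' \<and> S \<subseteq> S' \<and> m' \<le> m + 3 * t \<and>
    (replicate k x \<in> S' \<or> length (replicate k x) = 1)"
  using straight_line_powers[OF assms(1) _ assms(2,3), of "[x]"]
  unfolding concat_replicate_singleton by simp

text \<open>A run of consecutive powers costs only two symbols each, as every power extends the
  previous one by a letter.\<close>

lemma straight_line_replicates: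
  assumes "straight_line S m" "replicate c x \<in> S \<or> length (replicate c x) = 1" "1 \<le> c"
  shows "\<exists>S' m'. straight_line S' m' \<and> S \<subseteq> S' \<and> m' \<le> m + 2 * l \<and>
    (\<forall>j\<le>l. replicate (c + j) x \<in> S' \<or> length (replicate (c + j) x) = 1)"
proof (induction l)
  case 0
  show ?case by (intro exI[of _ S] exI[of _ m]) (use assms in auto)
next
  case (Suc l)
  then obtain S' m' where S': "straight_line S' m'" "S \<subseteq> S'" "m' \<le> m + 2 * l"
    "\<And>j. j \<le> l \<Longrightarrow> replicate (c + j) x \<in> S' \<or> length (replicate (c + j) x) = 1" by blast
  let ?us = "[replicate (c + l) x, [x]]"
  have cc: "concat ?us = replicate (c + Suc l) x"
    by (simp add: replicate_append_same)
  have "straight_line (insert (concat ?us) S') (m' + length ?us)"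
    using S'(1) S'(4)[of l] by (intro straight_line.intros) auto
  moreover have "m' + length ?us \<le> m + 2 * Suc l" using S'(3) by simp
  moreover have "\<forall>j\<le>Suc l. replicate (c + j) x \<in> insert (concat ?us) S' \<or>
      length (replicate (c + j) x) = 1"
    using S'(4) unfolding cc by (metis insertCI le_Suc_eq)
  ultimately show ?case using S'(2) by blast
qed

text \<open>The budget: \<open>3 * t\<close> for \<open>x^(m-l)\<close>, \<open>2 * l\<close> for
  the longer powers of \<open>x\<close>, \<open>2 * l\<close> for the powers of \<open>y\<close>,
  \<open>2 * l + 1\<close> for the period, \<open>3 * t\<close> for its power, \<open>3 * t\<close>
  for the padding and 2 for joining them.\<close>

lemma g_period_word_le:
  assumes "1 \<le> l" "l < m" "m \<le> 2 ^ t" "1 \<le> k" "k < 2 ^ t" "1 \<le> e" "e < 2 ^ t"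
  shows "g (concat (replicate k (period_word x y m l)) @ replicate e x) \<le> 9 * t + 6 * l + 3"
proof -
  let ?av = "\<lambda>u S. u \<in> S \<or> length u = (1::nat)"
  let ?P = "period_word x y m l"
  have "1 \<le> m - l" "m - l < 2 ^ t" using assms by auto
  from straight_line_replicate[OF straight_line.empty this, of x] obtain S1 m1
    where 1: "straight_line S1 m1" "m1 \<le> 3 * t" "?av (replicate (m - l) x) S1" by auto
  from straight_line_replicates[OF 1(1,3) \<open>1 \<le> m - l\<close>, of l] obtain S2 m2
    where 2: "straight_line S2 m2" "m2 \<le> m1 + 2 * l" "\<forall>j\<le>l. ?av (replicate (m - l + j) x) S2"
    by auto
  have "?av (replicate 1 y) S2" by simp
  from straight_line_replicates[OF 2(1) this, of l] obtain S3 m3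
    where 3: "straight_line S3 m3" "S2 \<subseteq> S3" "m3 \<le> m2 + 2 * l"
      "\<forall>j\<le>l. ?av (replicate (1 + j) y) S3"
    by auto
  define us where
    "us = concat (map (\<lambda>j. [replicate j y, replicate (m - j) x]) [1..<Suc l]) @ [[x]]"
  have "concat us = ?P"
    unfolding us_def period_word_def concat_append by (induction l) auto
  moreover have "length us = 2 * l + 1"
    unfolding us_def by (induction l) auto
  moreover have "?av u S3" if "u \<in> set us" for u
  proof -
    from that consider "u = [x]" | j where "1 \<le> j" "j \<le> l" "u = replicate j y"
      | j where "1 \<le> j" "j \<le> l" "u = replicate (m - j) x"
      by (auto simp: us_def simp del: upt_Suc)
    then show ?thesis
    proof cases
      case 2
      then have "u = replicate (1 + (j - 1)) y" "j - 1 \<le> l" by auto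
      then show ?thesis using 3(4) by blast
    next
      case 3
      then have "u = replicate (m - l + (l - j)) x" "l - j \<le> l" using assms(2) by auto
      then show ?thesis using 2(3) \<open>S2 \<subseteq> S3\<close> by blast
    qed simp
  qed
  ultimately have 4: "straight_line (insert ?P S3) (m3 + (2 * l + 1))"
    using straight_line.insert[OF 3(1), of us] by (metis One_nat_def Zero_not_Suc add_Suc_right list.size(3))
  from straight_line_powers[OF 4, of ?P k t] assms obtain S5 m5
    where 5: "straight_line S5 m5" "m5 \<le> m3 + (2 * l + 1) + 3 * t" "?av (concat (replicate k ?P)) S5"
    by auto
  from straight_line_replicate[OF 5(1) assms(6,7), of x] obtain S6 m6
    where 6: "straight_line S6 m6" "S5 \<subseteq> S6" "m6 \<le> m5 + 3 * t" "?av (replicate e x) S6"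
    by blast
  let ?vs = "[concat (replicate k ?P), replicate e x]"
  have "straight_line (insert (concat ?vs) S6) (m6 + length ?vs)"
    using 5(3) 6 by (intro straight_line.intros) auto
  then have "g (concat ?vs) \<le> m6 + length ?vs" by (rule g_le_straight_line) simp
  moreover have "m6 + length ?vs \<le> 9 * t + 6 * l + 3"
    using 1(2) 2(2) 3(3) 5(2) 6(3) by simp
  ultimately show ?thesis by simp
qed

section \<open>Choice of the parameters and the resulting ratio\<close>

lemma cube_le_two_power:
  fixes n :: nat
  assumes "16 \<le> n"
  shows "16 * n ^ 3 \<le> 2 ^ n"
  using assms
proof (induction n rule: dec_induct)
  case (step n)
  have "16 * n \<le> n\<^sup>2" using step.hyps(1) by (simp add: power2_eq_square)
  then have "3 * n\<^sup>2 + 3 * n + 1 \<le> 7 * n\<^sup>2"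
    using step.hyps(1) by linarith
  also have "\<dots> \<le> n * n\<^sup>2" using step.hyps(1) by (intro mult_right_mono) auto
  finally have "(Suc n) ^ 3 \<le> 2 * n ^ 3"
    by (simp add: power3_eq_cube power2_eq_square algebra_simps)
  with step.IH show ?case by simp
qed simp

text \<open>This makes \<open>2 ^ c\<close> of order \<open>sqrt (2 ^ J / J)\<close>. The bound
  \<open>J \<le> 2 ^ c\<close> holds since otherwise \<open>2 ^ J < 16 * J ^ 3\<close>; it leaves
  room in a block for both the shift and the run.\<close>

lemma exists_block_exponent:
  fixes J :: nat
  assumes "16 \<le> J"
  obtains c where "4 ^ (c + 1) * J \<le> 2 ^ J" "2 ^ J < 4 ^ (c + 2) * J" "J \<le> 2 ^ c"
proof -
  define c where "c = (LEAST c. 2 ^ J < 4 ^ (c + 2) * J)"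
  have cube: "16 * J ^ 3 \<le> 2 ^ J" by (rule cube_le_two_power[OF assms])
  have "(2::nat) ^ J < 2 ^ (J + 2)" by (rule power_strict_increasing) auto
  also have "\<dots> \<le> 4 ^ (J + 2)" by (rule power_mono) auto
  also have "\<dots> \<le> 4 ^ (J + 2) * J" using assms by simp
  finally have upper: "2 ^ J < 4 ^ (c + 2) * J" unfolding c_def by (rule LeastI)
  have lower: "4 ^ (c + 1) * J \<le> 2 ^ J"
  proof (cases c)
    \<comment> \<open>Minimality says nothing here, so the cubic estimate is used instead.\<close>
    case 0
    have "4 * J \<le> 16 * J ^ 3" using assms by (simp add: power3_eq_cube)
    with cube 0 show ?thesis by simp
  next
    case (Suc i)
    then have "i < (LEAST c. 2 ^ J < 4 ^ (c + 2) * J)" unfolding c_def by linarith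
    from not_less_Least[OF this] have "4 ^ (i + 2) * J \<le> 2 ^ J" by (simp only: not_less)
    then show ?thesis by (simp add: Suc)
  qed
  have "J \<le> 2 ^ c"
  proof (rule ccontr)
    assume "\<not> J \<le> 2 ^ c"
    then have "(2 ^ c) * (2 ^ c) \<le> J * J" by (intro mult_mono) auto
    then have "4 ^ c \<le> J * J" by (simp flip: power_mult_distrib)
    then have "16 * 4 ^ c * J \<le> 16 * (J * J) * J" by (intro mult_right_mono) auto
    with upper cube show False by (simp add: power3_eq_cube mult.assoc)
  qed
  with upper lower that show ?thesis by blast
qed

lemma exists_large_ratio:
  assumes "2 ^ 16 < n" "2 \<le> k"
  shows "\<exists>w \<in> words k n. 1 / 108 * sqrt (real n / log 2 (real n))
    \<le> real (slp_size (bisection w)) / real (g w)"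
proof -
  define J where "J = split_exponent n"
  have n2: "2 \<le> n" using assms by simp
  have J: "2 ^ J < n" "n \<le> 2 ^ (J + 1)"
    using split_exponent[OF n2] by (simp_all add: J_def)
  have "(2::nat) ^ 16 < 2 ^ (J + 1)" using J(2) assms(1) by linarith
  then have "16 < J + 1" by (rule power_less_imp_less_exp[rotated]) simp
  then have J16: "16 \<le> J" by simp
  from exists_block_exponent[OF J16] obtain c where c: "4 ^ (c + 1) * J \<le> 2 ^ J"
    "2 ^ J < 4 ^ (c + 2) * J" "J \<le> 2 ^ c" by blast
  \<comment> \<open>\<open>R\<close> is the number of copies of the period and
    \<open>m = 2 * R\<close> the block length, so shifts below \<open>R\<close> and runs up to
    \<open>J \<le> R\<close> fit into a block.\<close>
  define R :: nat where "R = 2 ^ c"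
  define m :: nat where "m = 2 ^ (c + 1)"
  have m: "m = R + R" by (simp add: m_def R_def)
  have R1: "1 \<le> R" by (simp add: R_def)
  have JR: "J \<le> R" using c(3) by (simp add: R_def)
  have RJm: "R + J \<le> m" using JR m by simp
  have four: "(4::nat) ^ (c + 1) = 4 * R * R" by (simp add: R_def flip: power_mult_distrib)
  have big: "4 * R * R * J \<le> 2 ^ J" using c(1) four by simp
  let ?P = "period_word (1::nat) 2 m J"
  let ?us = "shifted_blocks (1::nat) 2 m J R"
  define e where "e = n - R * (J * m + 1)"
  have lenP: "length (concat (replicate R ?P)) = R * (J * m + 1)"
    using RJm by (simp add: length_concat sum_list_replicate length_period_word)
  \<comment> \<open>The copies have total length \<open>2 * R * R * J + R\<close>, which is at most
    \<open>2 ^ J < n\<close>; hence the padding is nonempty.\<close>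
  have "R \<le> 2 * R * R * J" using R1 J16 by simp
  moreover have "R * (J * m + 1) = 2 * R * R * J + R" by (simp add: m algebra_simps)
  ultimately have "R * (J * m + 1) \<le> 2 ^ J" using big by linarith
  then have e: "1 \<le> e" "e < 2 ^ (J + 1)" "R * (J * m + 1) + e = n"
    using J R1 unfolding e_def by auto
  define w where "w = concat (replicate R ?P) @ replicate e 1"
  have lenw: "length w = n" using e(3) unfolding w_def length_append lenP length_replicate .
  have "set ?P \<subseteq> {1, 2}" by (auto simp: period_word_def)
  then have "set w \<subseteq> {1..k}" using assms(2) unfolding w_def by fastforce
  with lenw have "w \<in> words k n" by (simp add: words_def)
  have "2 ^ c < (2::nat) ^ J"
  proof -
    have "R \<le> R * R * J" using R1 J16 by simp
    then have "R < 4 * R * R * J" using R1 by linarith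
    with big have "R < 2 ^ J" by linarith
    then show ?thesis by (simp only: R_def)
  qed
  then have "c < J" by (rule power_less_imp_less_exp[rotated]) simp
  have "g w \<le> 9 * (J + 1) + 6 * J + 3"
    unfolding w_def
  proof (rule g_period_word_le)
    show "m \<le> 2 ^ (J + 1)" unfolding m_def using \<open>c < J\<close> by (intro power_increasing) auto
    show "R < 2 ^ (J + 1)" unfolding R_def using \<open>c < J\<close> by (intro power_strict_increasing) auto
  qed (use J16 JR R1 m e in auto)
  then have g27: "g w \<le> 27 * J" using J16 by simp
  have w_blocks: "w = concat ?us @ (replicate R 1 @ replicate e 1)"
    by (simp add: w_def concat_replicate_period[OF RJm])
  have "2 * card (set ?us) \<le> slp_size (bisection w)"
  proof (rule card_blocks_le_bisection[OF lenw n2 w_blocks])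
    show "1 \<le> c + 1" by simp
    show "length u = 2 ^ (c + 1)" if "u \<in> set ?us" for u
      using that RJm unfolding m_def[symmetric]
      by (auto simp: set_shifted_blocks length_shifted_block)
    \<comment> \<open>All blocks lie in the left part of the first split.\<close>
    have "R * J * m \<le> 4 * R * R * J" by (simp add: m algebra_simps)
    with big show "length ?us * 2 ^ (c + 1) \<le> 2 ^ split_exponent n"
      unfolding length_shifted_blocks m_def[symmetric] J_def[symmetric] by linarith
  qed
  then have size: "2 * (R * J) \<le> slp_size (bisection w)"
    by (simp add: card_shifted_blocks)
  have "w \<noteq> []" using lenw n2 by auto
  have "0 < g w" using length_le_two_power_g[OF \<open>w \<noteq> []\<close>] lenw n2 by (cases "g w") auto
  have "real J \<le> log 2 (real n)"
  proof -
    have "real (2 ^ J) \<le> real n" using J(1) by (simp only: of_nat_le_iff less_imp_le)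
    then show ?thesis using n2 by (simp add: le_log_iff powr_realpow)
  qed
  \<comment> \<open>With \<open>log n \<ge> J\<close> this gives
    \<open>n / log n \<le> 32 * R^2\<close>, rounded up to \<open>(8 * R)^2\<close>. The ratio is at
    least \<open>2 * R / 27\<close>, and \<open>2 / (27 * 8) = 1 / 108\<close>.\<close>
  have "real n \<le> real (2 * (16 * R * R * J))"
  proof -
    have "2 ^ J \<le> 16 * R * R * J" using c(2) four by simp
    then show ?thesis using J(2) by (simp only: of_nat_le_iff) simp
  qed
  then have "real n / log 2 (real n) \<le> (2 * (16 * real R * real R * real J)) / real J"
    using \<open>real J \<le> log 2 (real n)\<close> J16 by (intro frac_le) auto
  also have "\<dots> \<le> (8 * real R)\<^sup>2" using J16 by (simp add: power2_eq_square)
  finally have "sqrt (real n / log 2 (real n)) \<le> 8 * real R"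
    by (intro real_le_lsqrt) auto
  then have "1 / 108 * sqrt (real n / log 2 (real n)) \<le> (2 * (real R * real J)) / (27 * real J)"
    using J16 by simp
  also have "\<dots> \<le> real (slp_size (bisection w)) / real (g w)"
  proof (rule frac_le)
    show "2 * (real R * real J) \<le> real (slp_size (bisection w))"
      using size by (metis of_nat_le_iff of_nat_mult of_nat_numeral)
    show "real (g w) \<le> 27 * real J" using g27 by (metis of_nat_le_iff of_nat_mult of_nat_numeral)
  qed (use \<open>0 < g w\<close> in auto)
  finally show ?thesis using \<open>w \<in> words k n\<close> by blast
qed

lemma finite_words: "finite (words k n)"
  using finite_lists_length_eq[of "{1..k}" n] by (simp add: words_def conj_commute)

theorem theorem3p2:
  "\<exists>c1 > (0::real). \<exists>c2 > (0::real). \<exists>n0::nat. \<forall>n \<ge> n0. \<forall>k::nat. 2 \<le> k \<and> k \<le> n \<longrightarrow>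
     c1 * sqrt (real n / log 2 (real n)) \<le> approx_ratio bisection k n \<and>
     approx_ratio bisection k n \<le> c2 * sqrt (real n / log 2 (real n))"
proof -
  \<comment> \<open>The threshold on \<open>n\<close> ensures that the split exponent is at least
    16, as the lower bound requires.\<close>
  have "1 / 108 * sqrt (real n / log 2 (real n)) \<le> approx_ratio bisection k n \<and>
      approx_ratio bisection k n \<le> 10 * sqrt (real n / log 2 (real n))"
    if n: "2 ^ 16 + 1 \<le> n" and k: "2 \<le> k" for n k
  proof
    let ?r = "\<lambda>w. real (slp_size (bisection w)) / real (g w)"
    have fin: "finite (?r ` words k n)" by (intro finite_imageI finite_words)
    have "2 ^ 16 < n" using n by linarith
    then obtain w where w: "w \<in> words k n" "1 / 108 * sqrt (real n / log 2 (real n)) \<le> ?r w"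
      using exists_large_ratio[OF _ k] by blast
    from w(1) have "?r w \<le> approx_ratio bisection k n"
      unfolding approx_ratio_def by (intro Max_ge fin imageI)
    with w(2) show "1 / 108 * sqrt (real n / log 2 (real n)) \<le> approx_ratio bisection k n"
      by linarith
    have "?r v \<le> 10 * sqrt (real n / log 2 (real n))" if "v \<in> words k n" for v
      using bisection_ratio_le[of v] that n by (simp add: words_def)
    \<comment> \<open>The witness \<open>w\<close> also shows that the maximum is taken over a
      nonempty set.\<close>
    then show "approx_ratio bisection k n \<le> 10 * sqrt (real n / log 2 (real n))"
      unfolding approx_ratio_def using w(1) by (intro Max.boundedI fin) auto
  qed
  then show ?thesis
    by (intro exI[of _ "1 / 108"] exI[of _ 10] conjI exI[of _ "2 ^ 16 + 1"]) auto
qed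

end
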